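(* Let $n$ be an even positive integer and let $j$ be a positive integer with $j \equiv 2 \pmod 4$ and $\gcd\left(\tfrac12 j, \tfrac12 n\right)=1$. Then $$\sum_{k=0}^{\frac12 n-1} \frac{\sin\left(\frac{(j-1)(2k+1)\pi}{2n}\right)\sin\left(\frac{(j+1)(2k+1)\pi}{2n}\right)}{\sin^2\left(\frac{(2k+1)\pi}{2n}\right)\sin^2\left(\frac{j(2k+1)\pi}{2n}\right)}=\frac{n^2}{4}.$$ *)

theory Defs
  imports Complex_Main "HOL-Number_Theory.Cong"
begin

end

theory Submission
  imports Defs
begin

text \<open>
  Since \<open>sin (a - b) sin (a + b) = sin\<^sup>2 a - sin\<^sup>2 b\<close>, each summand is
  \<open>1 / sin\<^sup>2 x - 1 / sin\<^sup>2 (j x)\<close>. Both resulting sums come from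
  \<open>\<Sum>k<N. 1 / sin\<^sup>2 (i (2k+1) \<pi> / (2N)) = N\<^sup>2\<close> for odd \<open>i\<close> coprime to \<open>N\<close>:
  the first is half of the case \<open>N = n\<close>, \<open>i = 1\<close>, the second is the case
  \<open>N = n/2\<close>, \<open>i = j/2\<close>. The identity itself is Parseval's: with \<open>\<theta> = i (2k+1) \<pi> / (2N)\<close> one has
  \<open>sin\<^sup>2 (N \<theta>) = 1\<close>, so \<open>1 / sin\<^sup>2 \<theta>\<close> is the Fejer kernel \<open>|\<Sum>l<N. e\<^bsup>2il\<theta>\<^esup>|\<^sup>2\<close>, and
  summing over \<open>k\<close> leaves only the diagonal terms.
\<close>

lemma cis_eq_1_imp_multiple_2pi:
  assumes "cis x = 1"
  obtains t :: int where "x = of_int t * 2 * pi"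
proof -
  have "cos x = 1"
    using assms by (metis cis.sel(1) one_complex.sel(1))
  then show thesis
    using that by (auto simp: cos_one_2pi_int)
qed

text \<open>The summands form a geometric progression whose ratio \<open>w\<close> is an
  \<open>N\<close>-th root of unity. Since \<open>i\<close> is coprime to \<open>N\<close> and
  \<open>N\<close> does not divide \<open>d\<close>, it does not divide \<open>d * i\<close> either,
  so \<open>w\<close> differs from 1 and the progression sums to zero.\<close>

lemma sum_cis_odd_multiples_eq_0:
  fixes i d :: int and N :: nat
  assumes "N > 0" "coprime i (int N)" "\<not> int N dvd d"
  shows "(\<Sum>k<N. cis (of_int d * (of_int i * (2 * real k + 1) * pi / real N))) = 0"
proof -
  define w where "w = cis (2 * pi * of_int (d * i) / real N)"
  have "w \<noteq> 1"
  proof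
    assume "w = 1"
    then obtain t :: int where "2 * pi * of_int (d * i) / real N = of_int t * 2 * pi"
      unfolding w_def by (rule cis_eq_1_imp_multiple_2pi)
    then have "of_int (d * i) = (of_int (t * int N) :: real)"
      using assms(1) by (simp add: field_simps)
    then have "int N dvd d * i"
      by (metis dvd_triv_right of_int_eq_iff)
    then show False
      using assms(2,3) by (simp add: coprime_dvd_mult_left_iff coprime_commute)
  qed
  moreover have "w ^ N = 1"
  proof -
    have "w ^ N = cis (2 * pi * of_int (d * i))"
      using assms(1) by (simp add: w_def DeMoivre)
    then show ?thesis
      by (metis Ints_of_int cis_multiple_2pi)
  qed
  ultimately have "(\<Sum>k<N. w ^ k) = 0"
    by (simp add: geometric_sum)
  moreover have "cis (of_int d * (of_int i * (2 * real k + 1) * pi / real N))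
      = cis (of_int (d * i) * pi / real N) * w ^ k" for k
    using assms(1) by (simp add: w_def DeMoivre cis_mult field_simps)
  ultimately show ?thesis
    by (simp flip: sum_distrib_left)
qed

text \<open>A zero would put the angle at \<open>t * pi\<close> and force
  \<open>i * (2 * k + 1) = 2 * N * t\<close>, an odd number equal to an even one.\<close>

lemma sin_odd_multiple_neq_0:
  fixes i :: int and N k :: nat
  assumes "N > 0" "odd i"
  shows "sin (of_int i * (2 * real k + 1) * pi / (2 * real N)) \<noteq> 0"
proof
  assume "sin (of_int i * (2 * real k + 1) * pi / (2 * real N)) = 0"
  then obtain t :: int where "of_int i * (2 * real k + 1) * pi / (2 * real N) = of_int t * pi"
    by (auto simp: sin_zero_iff_int2)
  then have "pi * of_int (i * (2 * int k + 1)) = pi * of_int (2 * (int N * t))"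
    using assms(1) by (simp add: field_simps)
  then have "of_int (i * (2 * int k + 1)) = (of_int (2 * (int N * t)) :: real)"
    by (subst (asm) mult_cancel_left) simp
  then have "i * (2 * int k + 1) = 2 * (int N * t)"
    by (simp only: of_int_eq_iff)
  then have "even (i * (2 * int k + 1))"
    by simp
  then show False
    using assms(2) by simp
qed

text \<open>The squared chord between two points of the unit circle; it turns the denominator of a
  geometric sum of \<open>cis\<close> powers into a sine.\<close>

lemma norm_cis_minus_1_squared: "(norm (cis (2 * x) - 1))\<^sup>2 = 4 * (sin x)\<^sup>2"
proof -
  have "(norm (cis (2 * x) - 1))\<^sup>2 = (cos (2 * x) - 1)\<^sup>2 + (sin (2 * x))\<^sup>2"
    by (simp add: cmod_power2)
  also have "\<dots> = (cos (2 * x))\<^sup>2 + (sin (2 * x))\<^sup>2 + 1 - 2 * cos (2 * x)"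
    by (simp add: power2_eq_square algebra_simps del: sin_cos_squared_add sin_cos_squared_add2)
  also have "\<dots> = 2 - 2 * cos (2 * x)"
    by simp
  also have "\<dots> = 4 * (sin x)\<^sup>2"
    by (simp add: cos_double_sin)
  finally show ?thesis .
qed

lemma sum_inverse_sin_squared_odd_multiples:
  fixes i :: int and N :: nat
  assumes "N > 0" "odd i" "coprime i (int N)"
  shows "(\<Sum>k<N. 1 / (sin (of_int i * (2 * real k + 1) * pi / (2 * real N)))\<^sup>2) = (real N)\<^sup>2"
proof -
  define \<theta> where "\<theta> k = of_int i * (2 * real k + 1) * pi / (2 * real N)" for k
  define S where "S k = (\<Sum>l<N. cis (2 * \<theta> k) ^ l)" for k
  have norm_S: "(norm (S k))\<^sup>2 = 1 / (sin (\<theta> k))\<^sup>2" for k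
  proof -
    have "real N * (2 * \<theta> k) = of_int (i * (2 * int k + 1)) * pi"
      using assms(1) by (simp add: \<theta>_def)
    \<comment> \<open>The angle is an odd multiple of \<pi>, so the \<open>N\<close>-th power is -1
      and the geometric sum telescopes to -1 - 1 = -2.\<close>
    then have "cis (2 * \<theta> k) ^ N = cis (of_int (i * (2 * int k + 1)) * pi)"
      by (simp only: DeMoivre)
    also have "\<dots> = -1"
    proof -
      have "odd (i * (2 * int k + 1))"
        using assms(2) by simp
      then have "cis (pi * of_int (i * (2 * int k + 1))) = -1"
        by (simp only: complex_eq_iff cis.sel cos_npi_int sin_npi_int) simp
      then show ?thesis
        by (subst mult.commute)
    qed
    finally have "(cis (2 * \<theta> k) - 1) * S k = -2"
      unfolding S_def by (simp flip: power_diff_1_eq)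
    then have "norm ((cis (2 * \<theta> k) - 1) * S k) = 2"
      by simp
    then have "(norm (cis (2 * \<theta> k) - 1))\<^sup>2 * (norm (S k))\<^sup>2 = 2\<^sup>2"
      by (simp only: norm_mult flip: power_mult_distrib)
    then have "(sin (\<theta> k))\<^sup>2 * (norm (S k))\<^sup>2 = 1"
      by (simp add: norm_cis_minus_1_squared)
    then show ?thesis
      \<comment> \<open>If the sine vanished, the preceding equation would read 0 = 1.\<close>
      by (cases "sin (\<theta> k) = 0") (simp_all add: field_simps)
  qed
  have orthogonality: "(\<Sum>k<N. cis (2 * \<theta> k) ^ l * cnj (cis (2 * \<theta> k) ^ l'))
      = (if l = l' then of_nat N else 0)" if "l < N" "l' < N" for l l'
  proof -
    have *: "cis (2 * \<theta> k) ^ l * cnj (cis (2 * \<theta> k) ^ l')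
        = cis (of_int (int l - int l') * (of_int i * (2 * real k + 1) * pi / real N))" for k
    proof -
      have "of_int i * (2 * real k + 1) * pi / real N = 2 * \<theta> k"
        by (simp add: \<theta>_def)
      then show ?thesis
        by (simp only: DeMoivre cis_cnj cis_mult) (simp add: algebra_simps)
    qed
    show ?thesis
    proof (cases "l = l'")
      case True
      then show ?thesis unfolding * by simp
    next
      case False
      \<comment> \<open>The difference is nonzero and smaller than \<open>N\<close> in absolute
        value.\<close>
      have "\<not> int N dvd int l - int l'"
        using False that dvd_imp_le_int[of "int l - int l'" "int N"] by auto
      then show ?thesis
        unfolding * using sum_cis_odd_multiples_eq_0[OF assms(1,3)] False by (simp only: if_False)
    qed
  qed
  have "of_real (\<Sum>k<N. (norm (S k))\<^sup>2) = (\<Sum>k<N. S k * cnj (S k))"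
    by (simp only: of_real_sum complex_norm_square)
  also have "\<dots> = (\<Sum>k<N. \<Sum>l<N. \<Sum>l'<N. cis (2 * \<theta> k) ^ l * cnj (cis (2 * \<theta> k) ^ l'))"
    by (simp only: S_def cnj_sum sum_product)
  \<comment> \<open>Two swaps bring the sum over \<open>k\<close> innermost, where orthogonality
    applies.\<close>
  also have "\<dots> = (\<Sum>l<N. \<Sum>l'<N. \<Sum>k<N. cis (2 * \<theta> k) ^ l * cnj (cis (2 * \<theta> k) ^ l'))"
    by (rule trans[OF sum.swap], rule sum.cong[OF refl], rule sum.swap)
  also have "\<dots> = (\<Sum>l<N. \<Sum>l'<N. if l = l' then of_nat N else 0)"
    by (intro sum.cong refl orthogonality) auto
  also have "\<dots> = of_real ((real N)\<^sup>2)"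
    by (simp add: power2_eq_square)
  finally have "(\<Sum>k<N. (norm (S k))\<^sup>2) = (real N)\<^sup>2"
    by (simp only: of_real_eq_iff)
  then show ?thesis
    by (simp add: norm_S \<theta>_def)
qed

text \<open>Replacing \<open>k\<close> by \<open>2 * m - 1 - k\<close> reflects the angle x to \<pi>
  - x and keeps its sine. The full sum over \<open>2 * m\<close> terms, which is
  \<open>(2 * m)\<^sup>2\<close>, thus consists of two equal halves.\<close>

lemma sum_inverse_sin_squared_half:
  fixes m :: nat
  assumes "m > 0"
  shows "(\<Sum>k<m. 1 / (sin ((2 * real k + 1) * pi / (4 * real m)))\<^sup>2) = 2 * (real m)\<^sup>2"
proof -
  define f where "f k = 1 / (sin ((2 * real k + 1) * pi / (4 * real m)))\<^sup>2" for k
  have refl_f: "f (2 * m - Suc k) = f k" if "k < m" for k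
  proof -
    have "(2 * real (2 * m - Suc k) + 1) * pi / (4 * real m)
        = pi - (2 * real k + 1) * pi / (4 * real m)"
      using that by (simp add: of_nat_diff field_simps)
    then show ?thesis
      by (simp only: f_def sin_pi_minus)
  qed
  have "4 * (real m)\<^sup>2 = (\<Sum>k<2 * m. f k)"
    using sum_inverse_sin_squared_odd_multiples[of "2 * m" 1] assms by (simp add: f_def)
  also have "\<dots> = (\<Sum>k<m. f k) + (\<Sum>k=m..<2 * m. f k)"
    using assms by (simp add: sum.atLeastLessThan_concat lessThan_atLeast0)
  also have "(\<Sum>k=m..<2 * m. f k) = (\<Sum>k<m. f k)"
    by (rule sum.reindex_bij_witness[of _ "\<lambda>k. 2 * m - Suc k" "\<lambda>k. 2 * m - Suc k"])
      (auto simp: refl_f[symmetric])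
  finally show ?thesis
    by (simp add: f_def)
qed

lemma sin_diff_times_sin_add:
  fixes a b :: real
  shows "sin (a - b) * sin (a + b) = (sin a)\<^sup>2 - (sin b)\<^sup>2"
proof -
  have "sin (a - b) * sin (a + b) = (sin a)\<^sup>2 * (cos b)\<^sup>2 - (cos a)\<^sup>2 * (sin b)\<^sup>2"
    by (simp add: sin_diff sin_add power2_eq_square algebra_simps)
  then show ?thesis
    by (simp add: cos_squared_eq algebra_simps)
qed

theorem theorem2p2:
  fixes n j :: nat
  assumes "n > 0" and "even n"
    and "j > 0" and "[j = 2] (mod 4)"
    and "gcd (j div 2) (n div 2) = 1"
  shows "(\<Sum>k = 0..n div 2 - 1.
            (sin ((real j - 1) * (2 * real k + 1) * pi / (2 * real n))
              * sin ((real j + 1) * (2 * real k + 1) * pi / (2 * real n)))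
            / ((sin ((2 * real k + 1) * pi / (2 * real n)))\<^sup>2
              * (sin (real j * (2 * real k + 1) * pi / (2 * real n)))\<^sup>2))
         = (real n)\<^sup>2 / 4"
proof -
  define m i where "m = n div 2" and "i = j div 2"
  have n: "n = 2 * m" and m: "m > 0"
    using assms(1,2) by (auto simp: m_def)
  have "j mod 4 = 2"
    using assms(4) by (simp add: cong_def)
  \<comment> \<open>Writing j = 4q + 2 gives i = 2q + 1.\<close>
  then have j: "j = 2 * i" and i: "odd (int i)"
    unfolding i_def by presburger+
  have coprime: "coprime (int i) (int m)"
    using assms(5) by (simp add: m_def i_def coprime_iff_gcd_eq_1)
  define f where "f k = 1 / (sin ((2 * real k + 1) * pi / (4 * real m)))\<^sup>2" for k
  define g where "g k = 1 / (sin (of_int (int i) * (2 * real k + 1) * pi / (2 * real m)))\<^sup>2" for k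
  have summand: "(sin ((real j - 1) * (2 * real k + 1) * pi / (2 * real n))
              * sin ((real j + 1) * (2 * real k + 1) * pi / (2 * real n)))
            / ((sin ((2 * real k + 1) * pi / (2 * real n)))\<^sup>2
              * (sin (real j * (2 * real k + 1) * pi / (2 * real n)))\<^sup>2) = f k - g k" for k
  proof -
    \<comment> \<open>In terms of \<open>x\<close> the angles in the numerator are
      \<open>j * x - x\<close> and \<open>j * x + x\<close>. Both sines in the denominator must be
      nonzero for the quotient to split.\<close>
    define x where "x = (2 * real k + 1) * pi / (2 * real n)"
    have x: "x = (2 * real k + 1) * pi / (4 * real m)"
      "real j * x = of_int (int i) * (2 * real k + 1) * pi / (2 * real m)"
      using m by (simp_all add: x_def n j field_simps)
    have "sin x \<noteq> 0"
      using sin_odd_multiple_neq_0[of "2 * m" 1 k] m by (simp add: x)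
    moreover have "sin (real j * x) \<noteq> 0"
      unfolding x(2) using m i by (rule sin_odd_multiple_neq_0)
    ultimately have "(sin (real j * x - x) * sin (real j * x + x))
        / ((sin x)\<^sup>2 * (sin (real j * x))\<^sup>2) = 1 / (sin x)\<^sup>2 - 1 / (sin (real j * x))\<^sup>2"
      by (simp add: sin_diff_times_sin_add diff_divide_distrib)
    also have "\<dots> = f k - g k"
      by (simp only: f_def g_def x(2)) (simp add: x(1))
    finally show ?thesis
      by (simp add: x_def algebra_simps add_divide_distrib diff_divide_distrib)
  qed
  \<comment> \<open>Subtraction on naturals truncates, so this relies on
    \<open>m > 0\<close>.\<close>
  have "{0..n div 2 - 1} = {..<m}"
    using m by (auto simp: n)
  \<comment> \<open>The two sums give 2m^2 - m^2 = m^2, and m = n/2.\<close>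
  then show ?thesis
    using sum_inverse_sin_squared_half[OF m] sum_inverse_sin_squared_odd_multiples[OF m i coprime]
    by (simp only: summand sum_subtractf flip: f_def g_def) (simp add: n power_mult_distrib)
qed

end
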